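(* The two automorphisms $d_1,I:\mathcal A_{q=1,t}\to\mathcal A_{q=1,t}$ define an action of the mapping class group $\mathrm{Mod}(\Sigma_2)$ of the closed genus two surface on $\mathcal A_{q=1,t}$. That is, there is a group homomorphism $\mathrm{Mod}(\Sigma_2)\to\mathrm{Aut}(\mathcal A_{q=1,t})$ sending, for $1\le i\le5$, the Dehn twist generator $d_i$ to $I^{\,i-1}\circ d_1\circ I^{\,1-i}$, and sending the mapping class $d_1d_2d_3d_4d_5$ to the automorphism $I$.
   Context: $\mathcal A_{q=1,t}$ is the commutative algebra over $\mathbf k_t=\mathbb C(t^{1/4})$ with 15 generators $O_1,\dots,O_6$, $O_{12},O_{23},O_{34},O_{45},O_{56},O_{61}$, $O_{123},O_{234},O_{345}$. Indices are read cyclically modulo 6 with values in $\{1,\dots,6\}$, and $O_{456}:=O_{123}$, $O_{561}:=O_{234}$, $O_{612}:=O_{345}$. With $\kappa=t^{1/2}+t^{-1/2}$ the relations are ($1\le i\le6$): (a) $O_{i+2}O_{i+4}+O_{i+3}O_{i+2,i+3,i+4}-O_{i+2,i+3}O_{i+3,i+4}-\kappa O_i=0$; (b) $-O_{i+3}O_{i+5,i}-O_{i+4}O_{i+1,i+2}+O_{i+3,i+4}O_{i+1,i+2,i+3}-\kappa(O_{i,i+1}-O_iO_{i+1})=0$; (c) $-O_{i+1,i+2}O_{i+4,i+5}+O_{i,i+1,i+2}O_{i+1,i+2,i+3}-O_iO_{i+3}-\kappa(-O_{i+2,i+3,i+4}+O_{i+1}O_{i+5,i}+O_{i+5}O_{i,i+1}-O_iO_{i+1}O_{i+5})=0$;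 (d) $O_{123}O_{234}O_{345}-(O_1O_4O_{345}+O_2O_5O_{123}+O_3O_6O_{234})+\frac\kappa2(O_1O_6O_{61}+O_2O_1O_{12}+O_3O_2O_{23}+O_4O_3O_{34}+O_5O_4O_{45}+O_6O_5O_{56})-(O_1O_3O_5+O_2O_4O_6)-\frac\kappa2(O_{12}^2+O_{23}^2+O_{34}^2+O_{45}^2+O_{56}^2+O_{61}^2)+\kappa^3=0$. $I$ is the automorphism $O_i\mapsto O_{i+1}$, $O_{i,i+1}\mapsto O_{i+1,i+2}$, $O_{123}\mapsto O_{234}\mapsto O_{345}\mapsto O_{123}$. $d_1$ is the automorphism $O_2\mapsto O_1O_2-O_{12}$, $O_6\mapsto O_{61}$, $O_{12}\mapsto O_2$, $O_{23}\mapsto O_1O_{23}-O_{123}$, $O_{56}\mapsto O_{234}$, $O_{61}\mapsto O_1O_{61}-O_6$, $O_{123}\mapsto O_{23}$, $O_{234}\mapsto O_1O_{234}-O_{56}$, fixing the other generators. Automorphisms are composed as functions. $\mathrm{Mod}(\Sigma_2)$ is generated by Dehn twists $d_1,\dots,d_5$ along a chain of five simple closed curves, with relations $d_id_{i+1}d_i=d_{i+1}d_id_{i+1}$ ($1\le i\le4$), $d_id_j=d_jd_i$ ($|i-j|>1$), $I^6=1$, $H^2=1$, $Hd_i=d_iH$, where $I=d_1d_2d_3d_4d_5$ and $H=d_1d_2d_3d_4d_5d_5d_4d_3d_2d_1$. *)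

theory Defs
  imports
    "HOL-Library.Poly_Mapping"
    "HOL-Computational_Algebra.Fraction_Field"
    "HOL-Algebra.QuotRing"
    "HOL-Algebra.Bij"
    "HOL-Algebra.Algebraic_Closure_Type"
begin

section \<open>The algebra\<close>

text \<open>The ground field \<open>k_t\<close> is the field of fractions of the polynomial ring over the complex
  numbers in one indeterminate, and that indeterminate plays the role of \<open>t^(1/4)\<close>.\<close>

type_synonym kt = "complex poly fract"

definition t_quarter :: kt where
  "t_quarter = Fract [:0, 1:] 1"

definition kappa :: kt where
  "kappa = t_quarter ^ 2 + inverse (t_quarter ^ 2)"

datatype gen = O1 | O2 | O3 | O4 | O5 | O6
  | O12 | O23 | O34 | O45 | O56 | O61
  | O123 | O234 | O345

text \<open>Polynomials in the generators with coefficients in \<open>k_t\<close>: finitely supported maps from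
  exponent vectors to coefficients.  The multiplication of this type is the convolution product.\<close>

type_synonym gpoly = "(gen \<Rightarrow>\<^sub>0 nat) \<Rightarrow>\<^sub>0 kt"

definition const :: "kt \<Rightarrow> gpoly" where
  "const c = Poly_Mapping.single 0 c"

definition V :: "gen \<Rightarrow> gpoly" where
  "V g = Poly_Mapping.single (Poly_Mapping.single g 1) 1"

text \<open>The generators with cyclic indices: \<open>S i\<close>, \<open>D i\<close> and \<open>T i\<close> stand for \<open>O_i\<close>,
  \<open>O_(i,i+1)\<close> and \<open>O_(i,i+1,i+2)\<close>.  The list entry at position 0 belongs to the index 6.
  Thus \<open>O_(i+5,i)\<close> is \<open>D (i+5)\<close>.  For triples the index only matters modulo 3, because \<open>O_456 = O_123\<close>, \<open>O_561 = O_234\<close> and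
  \<open>O_612 = O_345\<close>.\<close>

definition S :: "nat \<Rightarrow> gpoly" where
  "S i = V ([O6, O1, O2, O3, O4, O5] ! (i mod 6))"

definition D :: "nat \<Rightarrow> gpoly" where
  "D i = V ([O61, O12, O23, O34, O45, O56] ! (i mod 6))"

definition T :: "nat \<Rightarrow> gpoly" where
  "T i = V ([O345, O123, O234] ! (i mod 3))"

definition rel_a :: "nat \<Rightarrow> gpoly" where
  "rel_a i = S (i+2) * S (i+4) + S (i+3) * T (i+2) - D (i+2) * D (i+3) - const kappa * S i"

definition rel_b :: "nat \<Rightarrow> gpoly" where
  "rel_b i = - S (i+3) * D (i+5) - S (i+4) * D (i+1) + D (i+3) * T (i+1)
     - const kappa * (D i - S i * S (i+1))"

definition rel_c :: "nat \<Rightarrow> gpoly" where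
  "rel_c i = - D (i+1) * D (i+4) + T i * T (i+1) - S i * S (i+3)
     - const kappa * (- T (i+2) + S (i+1) * D (i+5) + S (i+5) * D i - S i * S (i+1) * S (i+5))"

definition rel_d :: gpoly where
  "rel_d = V O123 * V O234 * V O345
     - (V O1 * V O4 * V O345 + V O2 * V O5 * V O123 + V O3 * V O6 * V O234)
     + const (kappa / 2) * (V O1 * V O6 * V O61 + V O2 * V O1 * V O12 + V O3 * V O2 * V O23
         + V O4 * V O3 * V O34 + V O5 * V O4 * V O45 + V O6 * V O5 * V O56)
     - (V O1 * V O3 * V O5 + V O2 * V O4 * V O6)
     - const (kappa / 2) * (V O12 ^ 2 + V O23 ^ 2 + V O34 ^ 2 + V O45 ^ 2 + V O56 ^ 2 + V O61 ^ 2)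
     + const (kappa ^ 3)"

definition relations :: "gpoly set" where
  "relations = rel_a ` {1..6} \<union> rel_b ` {1..6} \<union> rel_c ` {1..6} \<union> {rel_d}"

abbreviation gpoly_ring :: "gpoly ring" where
  "gpoly_ring \<equiv> ring_of_type_algebra"

definition rel_ideal :: "gpoly set" where
  "rel_ideal = Idl\<^bsub>gpoly_ring\<^esub> relations"

definition \<A> :: "gpoly set ring" where
  "\<A> = gpoly_ring Quot rel_ideal"

definition cls :: "gpoly \<Rightarrow> gpoly set" where
  "cls p = rel_ideal +>\<^bsub>gpoly_ring\<^esub> p"

text \<open>Automorphisms of \<open>\<A>\<close> as an algebra over \<open>k_t\<close>.  As for \<^const>\<open>AutoGroup\<close>, they are
  extensional functions on the carrier and the group operation is composition of functions.\<close>

definition alg_auto :: "(gpoly set \<Rightarrow> gpoly set) set" where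
  "alg_auto = {f \<in> Bij (carrier \<A>). f \<in> ring_hom \<A> \<A> \<and> (\<forall>c. f (cls (const c)) = cls (const c))}"

definition Aut\<A> :: "(gpoly set \<Rightarrow> gpoly set) monoid" where
  "Aut\<A> = BijGroup (carrier \<A>) \<lparr>carrier := alg_auto\<rparr>"

fun I_image :: "gen \<Rightarrow> gpoly" where
  "I_image O1 = V O2"
| "I_image O2 = V O3"
| "I_image O3 = V O4"
| "I_image O4 = V O5"
| "I_image O5 = V O6"
| "I_image O6 = V O1"
| "I_image O12 = V O23"
| "I_image O23 = V O34"
| "I_image O34 = V O45"
| "I_image O45 = V O56"
| "I_image O56 = V O61"
| "I_image O61 = V O12"
| "I_image O123 = V O234"
| "I_image O234 = V O345"
| "I_image O345 = V O123"

fun d1_image :: "gen \<Rightarrow> gpoly" where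
  "d1_image O2 = V O1 * V O2 - V O12"
| "d1_image O6 = V O61"
| "d1_image O12 = V O2"
| "d1_image O23 = V O1 * V O23 - V O123"
| "d1_image O56 = V O234"
| "d1_image O61 = V O1 * V O61 - V O6"
| "d1_image O123 = V O23"
| "d1_image O234 = V O1 * V O234 - V O56"
| "d1_image g = V g"


section \<open>Groups given by generators and relations\<close>

text \<open>A letter \<open>(a, True)\<close> stands for the generator \<open>a\<close> and \<open>(a, False)\<close> for its inverse; a pair
  \<open>(l, r)\<close> in \<open>R\<close> stands for the relation \<open>l = r\<close>.\<close>

type_synonym 'a word = "('a \<times> bool) list"

inductive_set pres_rel :: "'a set \<Rightarrow> ('a word \<times> 'a word) set \<Rightarrow> ('a word \<times> 'a word) set"
  for G :: "'a set" and R :: "('a word \<times> 'a word) set" where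
  refl: "u \<in> lists (G \<times> UNIV) \<Longrightarrow> (u, u) \<in> pres_rel G R"
| sym: "(u, v) \<in> pres_rel G R \<Longrightarrow> (v, u) \<in> pres_rel G R"
| trans: "(u, v) \<in> pres_rel G R \<Longrightarrow> (v, w) \<in> pres_rel G R \<Longrightarrow> (u, w) \<in> pres_rel G R"
| app: "(u, v) \<in> pres_rel G R \<Longrightarrow> (u', v') \<in> pres_rel G R \<Longrightarrow> (u @ u', v @ v') \<in> pres_rel G R"
| cancel: "a \<in> G \<Longrightarrow> ([(a, b), (a, \<not> b)], []) \<in> pres_rel G R"
| rel: "(l, r) \<in> R \<Longrightarrow> l \<in> lists (G \<times> UNIV) \<Longrightarrow> r \<in> lists (G \<times> UNIV) \<Longrightarrow> (l, r) \<in> pres_rel G R"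

definition presented_group :: "'a set \<Rightarrow> ('a word \<times> 'a word) set \<Rightarrow> 'a word set monoid" where
  "presented_group G R =
    \<lparr>carrier = lists (G \<times> UNIV) // pres_rel G R,
     monoid.mult = (\<lambda>U V. \<Union>u\<in>U. \<Union>v\<in>V. pres_rel G R `` {u @ v}),
     one = pres_rel G R `` {[]}\<rparr>"


section \<open>The mapping class group of the closed genus two surface\<close>

abbreviation (input) tw :: "nat \<Rightarrow> nat word" where
  "tw i \<equiv> [(i, True)]"

definition I_word :: "nat word" where
  "I_word = tw 1 @ tw 2 @ tw 3 @ tw 4 @ tw 5"

definition H_word :: "nat word" where
  "H_word = tw 1 @ tw 2 @ tw 3 @ tw 4 @ tw 5 @ tw 5 @ tw 4 @ tw 3 @ tw 2 @ tw 1"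

definition Mod2_relations :: "(nat word \<times> nat word) set" where
  "Mod2_relations =
     {(tw i @ tw (i+1) @ tw i, tw (i+1) @ tw i @ tw (i+1)) | i. i \<in> {1..4}}
   \<union> {(tw i @ tw j, tw j @ tw i) | i j. i \<in> {1..5} \<and> j \<in> {1..5} \<and> \<bar>int i - int j\<bar> > 1}
   \<union> {(I_word @ I_word @ I_word @ I_word @ I_word @ I_word, [])}
   \<union> {(H_word @ H_word, [])}
   \<union> {(H_word @ tw i, tw i @ H_word) | i. i \<in> {1..5}}"

definition Mod2 :: "nat word set monoid" where
  "Mod2 = presented_group {1..5} Mod2_relations"

definition dehn :: "nat \<Rightarrow> nat word set" where
  "dehn i = pres_rel {1..5} Mod2_relations `` {tw i}"


section \<open>Basic facts\<close>

lemma pres_rel_lists: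
  assumes "(u, v) \<in> pres_rel G R"
  shows "u \<in> lists (G \<times> UNIV) \<and> v \<in> lists (G \<times> UNIV)"
  using assms by induction auto

lemma equiv_pres_rel: "equiv (lists (G \<times> UNIV)) (pres_rel G R)"
  by (rule equivI)
    (auto simp: refl_on_def sym_def trans_def
      intro: pres_rel.refl pres_rel.sym pres_rel.trans dest: pres_rel_lists)

lemma presented_group_mult:
  assumes "u \<in> lists (G \<times> UNIV)" "v \<in> lists (G \<times> UNIV)"
  shows "(pres_rel G R `` {u}) \<otimes>\<^bsub>presented_group G R\<^esub> (pres_rel G R `` {v}) = pres_rel G R `` {u @ v}"
proof -
  have "congruent2 (pres_rel G R) (pres_rel G R) (\<lambda>u v. pres_rel G R `` {u @ v})"
    by (rule congruent2I')
      (auto intro!: equiv_class_eq[OF equiv_pres_rel] pres_rel.app)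
  from UN_equiv_class2[OF equiv_pres_rel equiv_pres_rel this assms] show ?thesis
    by (simp add: presented_group_def)
qed

lemma group_presented_group: "group (presented_group G R)"
proof (rule groupI)
  let ?P = "presented_group G R" and ?r = "pres_rel G R" and ?L = "lists (G \<times> (UNIV :: bool set))"
  have one: "\<one>\<^bsub>?P\<^esub> = ?r `` {[]}" and car: "carrier ?P = ?L // ?r"
    by (simp_all add: presented_group_def)
  show "\<one>\<^bsub>?P\<^esub> \<in> carrier ?P"
    by (simp add: one car quotientI)
  have inverse: "\<exists>v \<in> ?L. (v @ u, []) \<in> ?r" if "u \<in> ?L" for u
    using that
  proof (induction u)
    case Nil
    then show ?case by (auto intro!: bexI[of _ "[]"] pres_rel.refl)
  next
    case (Cons x u)
    obtain a b where x: "x = (a, b)" "a \<in> G"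
      using Cons.hyps by auto
    obtain v where v: "v \<in> ?L" "(v @ u, []) \<in> ?r"
      using Cons by auto
    have u: "u \<in> ?L" using Cons by auto
    have "([(a, \<not> b), (a, b)], []) \<in> ?r"
      using pres_rel.cancel[of a G "\<not> b" R] x by simp
    from pres_rel.app[OF pres_rel.refl[OF v(1)] pres_rel.app[OF this pres_rel.refl[OF u]]]
    have "(v @ [(a, \<not> b), (a, b)] @ u, v @ u) \<in> ?r" by simp
    with v(2) have "((v @ [(a, \<not> b)]) @ x # u, []) \<in> ?r"
      using x by (auto intro: pres_rel.trans)
    moreover have "v @ [(a, \<not> b)] \<in> ?L" using v x by auto
    ultimately show ?case by blast
  qed
  fix x assume "x \<in> carrier ?P"
  then obtain u where u: "u \<in> ?L" "x = ?r `` {u}"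
    unfolding car by (rule quotientE)
  show "\<one>\<^bsub>?P\<^esub> \<otimes>\<^bsub>?P\<^esub> x = x"
    using u presented_group_mult[of "[]" G u R] by (simp add: one)
  obtain v where v: "v \<in> ?L" "(v @ u, []) \<in> ?r"
    using inverse[OF u(1)] by blast
  have "(?r `` {v}) \<otimes>\<^bsub>?P\<^esub> x = \<one>\<^bsub>?P\<^esub>"
    using u v presented_group_mult[of v G u R] equiv_class_eq[OF equiv_pres_rel v(2)]
    by (simp add: one)
  then show "\<exists>y\<in>carrier ?P. y \<otimes>\<^bsub>?P\<^esub> x = \<one>\<^bsub>?P\<^esub>"
    using v by (auto simp: car intro: quotientI)
  fix y assume "y \<in> carrier ?P"
  then obtain v where v: "v \<in> ?L" "y = ?r `` {v}"
    unfolding car by (rule quotientE)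
  have uv: "u @ v \<in> ?L" using u v by auto
  show "x \<otimes>\<^bsub>?P\<^esub> y \<in> carrier ?P"
    using presented_group_mult[OF u(1) v(1), of R] u v quotientI[OF uv]
    by (simp add: car)
  fix z assume "z \<in> carrier ?P"
  then obtain w where w: "w \<in> ?L" "z = ?r `` {w}"
    unfolding car by (rule quotientE)
  have "v @ w \<in> ?L" using v w by auto
  then show "x \<otimes>\<^bsub>?P\<^esub> y \<otimes>\<^bsub>?P\<^esub> z = x \<otimes>\<^bsub>?P\<^esub> (y \<otimes>\<^bsub>?P\<^esub> z)"
    using u v w uv by (simp only: presented_group_mult append_assoc)
qed

lemma group_Mod2: "group Mod2"
  by (simp add: Mod2_def group_presented_group)

lemma ideal_rel_ideal: "ideal rel_ideal gpoly_ring"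
proof -
  interpret cring gpoly_ring by (rule cring_from_type_algebra)
  show ?thesis
    unfolding rel_ideal_def by (rule genideal_ideal) (simp add: ring_of_type_algebra_def)
qed

lemma cring_\<A>: "cring \<A>"
  unfolding \<A>_def by (rule ideal.quotient_is_cring[OF ideal_rel_ideal cring_from_type_algebra])

lemma carrier_\<A>: "carrier \<A> = range cls"
  by (auto simp: \<A>_def FactRing_def A_RCOSETS_def' cls_def ring_of_type_algebra_def)

lemma cls_hom: "cls \<in> ring_hom gpoly_ring \<A>"
  using ideal.rcos_ring_hom[OF ideal_rel_ideal] unfolding cls_def[abs_def] \<A>_def .

lemma cls_add: "cls (p + q) = cls p \<oplus>\<^bsub>\<A>\<^esub> cls q"
  and cls_mult: "cls (p * q) = cls p \<otimes>\<^bsub>\<A>\<^esub> cls q"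
  and cls_one: "cls 1 = \<one>\<^bsub>\<A>\<^esub>"
  using ring_hom_add[OF cls_hom, of p q] ring_hom_mult[OF cls_hom, of p q] ring_hom_one[OF cls_hom]
  by (simp_all add: ring_of_type_algebra_def)

lemma subgroup_alg_auto: "subgroup alg_auto (BijGroup (carrier \<A>))"
proof -
  interpret cring \<A> by (rule cring_\<A>)
  interpret B: group "BijGroup (carrier \<A>)" by (rule group_BijGroup)
  show ?thesis
  proof (rule B.subgroupI)
    show "alg_auto \<subseteq> carrier (BijGroup (carrier \<A>))"
      by (auto simp: alg_auto_def BijGroup_def)
    have "(\<lambda>x\<in>carrier \<A>. x) \<in> alg_auto"
      by (auto simp: alg_auto_def id_Bij ring_hom_def carrier_\<A>[symmetric])
        (auto simp: carrier_\<A>)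
    then show "alg_auto \<noteq> {}" by blast
  next
    fix f assume f: "f \<in> alg_auto"
    then have B: "f \<in> Bij (carrier \<A>)" and h: "f \<in> ring_hom \<A> \<A>"
      and c: "\<And>c. f (cls (const c)) = cls (const c)"
      by (auto simp: alg_auto_def)
    let ?g = "restrict (inv_into (carrier \<A>) f) (carrier \<A>)"
    have bij: "bij_betw f (carrier \<A>) (carrier \<A>)" using B by (simp add: Bij_def)
    have fg: "f (?g x) = x" if "x \<in> carrier \<A>" for x
      using that bij_betw_inv_into_right[OF bij that] by simp
    have gx: "?g x \<in> carrier \<A>" if "x \<in> carrier \<A>" for x
      using that bij_betwE[OF bij_betw_inv_into[OF bij]] by simp
    have gf: "?g y = x" if "f x = y" "x \<in> carrier \<A>" for x y
      using that bij_betw_inv_into_left[OF bij that(2)] bij_betwE[OF bij] by force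
    have "?g \<in> ring_hom \<A> \<A>"
    proof (rule ring_hom_memI)
      fix x y assume xy: "x \<in> carrier \<A>" "y \<in> carrier \<A>"
      show "?g x \<in> carrier \<A>" by (rule gx[OF xy(1)])
      show "?g (x \<otimes>\<^bsub>\<A>\<^esub> y) = ?g x \<otimes>\<^bsub>\<A>\<^esub> ?g y"
        by (rule gf) (simp_all only: ring_hom_mult[OF h] fg gx xy m_closed)
      show "?g (x \<oplus>\<^bsub>\<A>\<^esub> y) = ?g x \<oplus>\<^bsub>\<A>\<^esub> ?g y"
        by (rule gf) (simp_all only: ring_hom_add[OF h] fg gx xy a_closed)
    next
      show "?g \<one>\<^bsub>\<A>\<^esub> = \<one>\<^bsub>\<A>\<^esub>"
        by (rule gf) (simp_all only: ring_hom_one[OF h] one_closed)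
    qed
    moreover have "?g (cls (const k)) = cls (const k)" for k
      by (rule gf) (auto simp: c carrier_\<A>)
    ultimately show "inv\<^bsub>BijGroup (carrier \<A>)\<^esub> f \<in> alg_auto"
      by (simp add: alg_auto_def inv_BijGroup[OF B] restrict_inv_into_Bij[OF B] del: restrict_apply)
  next
    fix f g assume f: "f \<in> alg_auto" and g: "g \<in> alg_auto"
    have "compose (carrier \<A>) f g \<in> ring_hom \<A> \<A>"
    proof (rule ring_hom_memI)
      have h: "f \<in> ring_hom \<A> \<A>" "g \<in> ring_hom \<A> \<A>"
        using f g by (auto simp: alg_auto_def)
      fix x y assume xy: "x \<in> carrier \<A>" "y \<in> carrier \<A>"
      note facts = h[THEN ring_hom_mult] h[THEN ring_hom_add] h[THEN ring_hom_one]
        h[THEN ring_hom_closed] xy m_closed a_closed compose_eq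
      show "compose (carrier \<A>) f g x \<in> carrier \<A>"
        by (simp only: facts)
      show "compose (carrier \<A>) f g (x \<otimes>\<^bsub>\<A>\<^esub> y)
          = compose (carrier \<A>) f g x \<otimes>\<^bsub>\<A>\<^esub> compose (carrier \<A>) f g y"
        by (simp only: facts)
      show "compose (carrier \<A>) f g (x \<oplus>\<^bsub>\<A>\<^esub> y)
          = compose (carrier \<A>) f g x \<oplus>\<^bsub>\<A>\<^esub> compose (carrier \<A>) f g y"
        by (simp only: facts)
    next
      show "compose (carrier \<A>) f g \<one>\<^bsub>\<A>\<^esub> = \<one>\<^bsub>\<A>\<^esub>"
        using f g by (simp add: alg_auto_def compose_eq ring_hom_one[of _ \<A> \<A>])
    qed
    then have "compose (carrier \<A>) f g \<in> alg_auto"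
      using f g by (simp add: alg_auto_def compose_Bij compose_eq carrier_\<A>)
    then show "f \<otimes>\<^bsub>BijGroup (carrier \<A>)\<^esub> g \<in> alg_auto"
      using f g by (simp add: alg_auto_def BijGroup_def)
  qed
qed

lemma group_Aut\<A>: "group Aut\<A>"
  unfolding Aut\<A>_def by (rule subgroup.subgroup_is_group[OF subgroup_alg_auto group_BijGroup])

text \<open>An automorphism is determined by its values on the generators.\<close>

lemma update_eq_single_add:
  "a \<notin> Poly_Mapping.keys f \<Longrightarrow> Poly_Mapping.update a b f = Poly_Mapping.single a b + f"
  by (intro poly_mapping_eqI) (auto simp: lookup_update lookup_add lookup_single when_def in_keys_iff)

lemma gpoly_induct:
  fixes p :: gpoly
  assumes const: "\<And>c. P (const c)"
    and V: "\<And>g. P (V g)"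
    and add: "\<And>p q. P p \<Longrightarrow> P q \<Longrightarrow> P (p + q)"
    and mult: "\<And>p q. P p \<Longrightarrow> P q \<Longrightarrow> P (p * q)"
  shows "P p"
proof -
  have mono1: "P (Poly_Mapping.single (Poly_Mapping.single g n) 1)" for g and n :: nat
  proof (induction n)
    case 0
    then show ?case using const[of 1] by (simp add: const_def)
  next
    case (Suc n)
    have "Poly_Mapping.single (Poly_Mapping.single g (Suc n)) 1
        = V g * Poly_Mapping.single (Poly_Mapping.single g n) 1"
      by (simp add: V_def mult_single single_add[symmetric])
    then show ?case using mult[OF V Suc] by simp
  qed
  have mono: "P (Poly_Mapping.single m 1)" for m
  proof (induction m rule: update_induct)
    case const
    then show ?case using assms(1)[of 1] by (simp add: const_def)
  next
    case (update f g n)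
    then show ?case
      using mult[OF mono1[of g n] update(3)] by (simp add: update_eq_single_add update mult_single)
  qed
  show ?thesis
  proof (induction p rule: update_induct)
    case const
    then show ?case using assms(1)[of 0] by (simp add: const_def)
  next
    case (update f m c)
    have "P (Poly_Mapping.single m c)"
      using mult[OF assms(1)[of c] mono[of m]] by (simp add: const_def mult_single)
    from add[OF this update(3)] show ?case
      by (simp add: update_eq_single_add update)
  qed
qed

lemma Aut\<A>_eqI:
  assumes f: "f \<in> carrier Aut\<A>" and g: "g \<in> carrier Aut\<A>"
    and eq: "\<And>x. f (cls (V x)) = g (cls (V x))"
  shows "f = g"
proof (rule extensionalityI)
  show "f \<in> extensional (carrier \<A>)" "g \<in> extensional (carrier \<A>)"
    using f g by (auto simp: Aut\<A>_def alg_auto_def Bij_def)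
  have h: "f \<in> ring_hom \<A> \<A>" "g \<in> ring_hom \<A> \<A>"
    and c: "\<And>c. f (cls (const c)) = g (cls (const c))"
    using f g by (auto simp: Aut\<A>_def alg_auto_def)
  fix x assume "x \<in> carrier \<A>"
  then obtain p where x: "x = cls p" by (auto simp: carrier_\<A>)
  show "f x = g x"
    unfolding x
  proof (induction p rule: gpoly_induct)
    case (3 p q)
    then show ?case
      by (simp add: cls_add ring_hom_add[OF h(1)] ring_hom_add[OF h(2)] carrier_\<A>)
  next
    case (4 p q)
    then show ?case
      by (simp add: cls_mult ring_hom_mult[OF h(1)] ring_hom_mult[OF h(2)] carrier_\<A>)
  qed (simp_all add: c eq)
qed

end

theory Submission
  imports Defs
begin

text \<open>
  Write \<open>d\<close>, \<open>I\<close> and \<open>s\<close> for the endomorphisms of the polynomial ring in the fifteen generators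
  given by the substitutions for \<open>d_1\<close>, for \<open>I\<close>, and for the reflection \<open>i \<mapsto> 2 - i\<close> of the
  hexagon of indices.

  \<^emph>\<open>Automorphisms.\<close>  \<open>I\<close> and \<open>s\<close> permute the defining relations, and \<open>d\<close> sends each of them to a
  short combination of relations (\<open>d1_rels\<close>, \<open>d1_rel_d\<close>), so all three act on \<open>\<A>\<close>.  Conjugation by
  the reflection inverts both mapping classes, and indeed \<open>d s d s = 1\<close> and \<open>I s I s = 1\<close> hold for
  the substitutions.  Hence the inverses of \<open>d\<close> and \<open>I\<close> are \<open>s d s\<close> and \<open>s I s\<close>, and these preserve
  the ideal of relations because \<open>d\<close>, \<open>I\<close> and \<open>s\<close> do.

  \<^emph>\<open>Group relations.\<close>  Put \<open>d_i = I^(i-1) d I^(1-i)\<close>.  Conjugation by \<open>I\<close> reduces the braid and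
  commutation relations to the braid relation of \<open>d_1, d_2\<close> and the commutation of \<open>d_1\<close> with \<open>d_3\<close>
  and \<open>d_4\<close>.  The products of the chain telescope:
  \<open>d_1 d_2 d_3 d_4 d_5 = (d I)^5 I^(-5)\<close> and \<open>d_5 d_4 d_3 d_2 d_1 = I^5 (I^(-1) d)^5\<close>.  So once
  \<open>I^6 = (d I)^5 = (I^(-1) d)^5 = 1\<close> is known, the first product is \<open>I\<close>, the second is \<open>I^(-1)\<close>,
  and \<open>H\<close> acts trivially, as a hyperelliptic involution should: it preserves the curves that the
  generators stand for.  This settles the relations containing \<open>H\<close> (\<open>Mod2_relations_shifted\<close>).

  \<^emph>\<open>What has to be computed.\<close>  All these identities except \<open>(d I)^5 = 1\<close> already hold for the
  substitutions in the polynomial ring.  For \<open>(d I)^5 = 1\<close> the point is the orbit of \<open>O_6\<close>.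
  Three steps forward and two steps backward lead to two polynomials whose difference, multiplied by
  \<open>\<kappa>\<close>, is the difference of the relations (c) for \<open>i = 2\<close> and \<open>i = 5\<close> (\<open>kappa_times_hexagon\<close>).  As
  \<open>\<kappa>\<close> is invertible in the ground field, \<open>O_6\<close> is fixed in \<open>\<A>\<close>; the other generators are
  either permuted in cycles of length five or are polynomials in elements already known to be fixed
  (\<open>rot_order_5\<close>).
\<close>


section \<open>Substitution homomorphisms of the polynomial ring\<close>

lemma const_0 [simp]: "const 0 = 0" and const_1 [simp]: "const 1 = 1"
  and const_add: "const (a + b) = const a + const b"
  and const_mult: "const (a * b) = const a * const b"
  by (simp_all add: const_def single_add mult_single)

definition monomial_value :: "(gen \<Rightarrow> gpoly) \<Rightarrow> (gen \<Rightarrow>\<^sub>0 nat) \<Rightarrow> gpoly" where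
  "monomial_value \<sigma> m = (\<Prod>g\<in>Poly_Mapping.keys m. \<sigma> g ^ Poly_Mapping.lookup m g)"

definition subst :: "(gen \<Rightarrow> gpoly) \<Rightarrow> gpoly \<Rightarrow> gpoly" where
  "subst \<sigma> p = (\<Sum>m\<in>Poly_Mapping.keys p. const (Poly_Mapping.lookup p m) * monomial_value \<sigma> m)"

text \<open>The index sets of the product and of the sum may be enlarged; this gives two polynomials, or
  two monomials, a common index set.\<close>

lemma monomial_value_superset:
  assumes "finite A" "Poly_Mapping.keys m \<subseteq> A"
  shows "monomial_value \<sigma> m = (\<Prod>g\<in>A. \<sigma> g ^ Poly_Mapping.lookup m g)"
  unfolding monomial_value_def using assms
  by (intro prod.mono_neutral_left) (auto simp: in_keys_iff)

lemma monomial_value_add: "monomial_value \<sigma> (m + n) = monomial_value \<sigma> m * monomial_value \<sigma> n"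
proof -
  let ?A = "Poly_Mapping.keys m \<union> Poly_Mapping.keys n"
  have "Poly_Mapping.keys (m + n) \<subseteq> ?A" by (rule keys_add)
  then have "monomial_value \<sigma> l = (\<Prod>g\<in>?A. \<sigma> g ^ Poly_Mapping.lookup l g)"
    if "l \<in> {m, n, m + n}" for l
    using that by (intro monomial_value_superset) auto
  then show ?thesis
    by (simp add: lookup_add power_add prod.distrib)
qed

lemma subst_superset:
  assumes "finite A" "Poly_Mapping.keys p \<subseteq> A"
  shows "subst \<sigma> p = (\<Sum>m\<in>A. const (Poly_Mapping.lookup p m) * monomial_value \<sigma> m)"
  unfolding subst_def using assms by (intro sum.mono_neutral_left) (auto simp: in_keys_iff)

lemma subst_add: "subst \<sigma> (p + q) = subst \<sigma> p + subst \<sigma> q"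
proof -
  let ?A = "Poly_Mapping.keys p \<union> Poly_Mapping.keys q"
  have "Poly_Mapping.keys (p + q) \<subseteq> ?A" by (rule keys_add)
  then show ?thesis
    by (simp add: subst_superset[of ?A] lookup_add const_add distrib_right sum.distrib)
qed

lemma subst_single: "subst \<sigma> (Poly_Mapping.single m c) = const c * monomial_value \<sigma> m"
  by (cases "c = 0") (simp_all add: subst_def)

lemma subst_mult_single:
  "subst \<sigma> (Poly_Mapping.single m c * q) = subst \<sigma> (Poly_Mapping.single m c) * subst \<sigma> q"
proof (induction q rule: update_induct)
  case const
  then show ?case by (simp add: subst_def)
next
  case (update f n b)
  then show ?case
    by (simp add: update_eq_single_add distrib_left subst_add mult_single subst_single
      monomial_value_add const_mult ac_simps)
qed

lemma subst_mult: "subst \<sigma> (p * q) = subst \<sigma> p * subst \<sigma> q"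
proof (induction p rule: update_induct)
  case const
  then show ?case by (simp add: subst_def)
next
  case (update f n b)
  then show ?case
    by (simp add: update_eq_single_add distrib_right subst_add subst_mult_single)
qed

lemma subst_const: "subst \<sigma> (const c) = const c"
  by (simp add: const_def[of c] subst_single monomial_value_def)

lemma subst_V: "subst \<sigma> (V g) = \<sigma> g"
  by (simp add: V_def subst_single monomial_value_def)

locale gpoly_endo =
  fixes f :: "gpoly \<Rightarrow> gpoly"
  assumes add: "f (p + q) = f p + f q"
    and mult: "f (p * q) = f p * f q"
    and const: "f (const c) = const c"
begin

lemma zero: "f 0 = 0" and one: "f 1 = 1"
  using const[of 0] const[of 1] by simp_all

lemma uminus: "f (- p) = - f p"
  using add[of p "- p"] zero by (simp add: eq_neg_iff_add_eq_0 add.commute)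

lemma diff: "f (p - q) = f p - f q"
  using add[of p "- q"] uminus by simp

lemma power: "f (p ^ n) = f p ^ n"
  by (induction n) (simp_all add: one mult)

lemmas hom_simps = add mult const zero one uminus diff power

end

lemma gpoly_endo_subst: "gpoly_endo (subst \<sigma>)"
  by unfold_locales (simp_all add: subst_add subst_mult subst_const)

lemma gpoly_endo_compose: "gpoly_endo f \<Longrightarrow> gpoly_endo g \<Longrightarrow> gpoly_endo (f \<circ> g)"
  by (simp add: gpoly_endo_def)

lemma gpoly_endo_id: "gpoly_endo id"
  by (simp add: gpoly_endo_def)

lemma gpoly_endo_eqI:
  assumes "gpoly_endo f" "gpoly_endo g" and "\<And>x. f (V x) = g (V x)"
  shows "f = g"
proof
  interpret f: gpoly_endo f by fact
  interpret g: gpoly_endo g by fact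
  fix p show "f p = g p"
    by (induction p rule: gpoly_induct) (simp_all add: assms(3) f.hom_simps g.hom_simps)
qed


section \<open>Congruence modulo the relations and induced automorphisms\<close>

lemma rel_ideal_zero: "0 \<in> rel_ideal"
  and rel_ideal_add: "p \<in> rel_ideal \<Longrightarrow> q \<in> rel_ideal \<Longrightarrow> p + q \<in> rel_ideal"
  and rel_ideal_mult: "p \<in> rel_ideal \<Longrightarrow> q * p \<in> rel_ideal"
proof -
  interpret ideal rel_ideal gpoly_ring by (rule ideal_rel_ideal)
  show "0 \<in> rel_ideal"
    using additive_subgroup.zero_closed[OF additive_subgroup_axioms]
    by (simp add: ring_of_type_algebra_def)
  show "p \<in> rel_ideal \<Longrightarrow> q \<in> rel_ideal \<Longrightarrow> p + q \<in> rel_ideal"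
    using additive_subgroup.a_closed[OF additive_subgroup_axioms, of p q]
    by (simp add: ring_of_type_algebra_def)
  show "p \<in> rel_ideal \<Longrightarrow> q * p \<in> rel_ideal"
    using I_l_closed[of p q] by (simp add: ring_of_type_algebra_def)
qed

lemma rel_ideal_uminus: "p \<in> rel_ideal \<Longrightarrow> - p \<in> rel_ideal"
  using rel_ideal_mult[of p "- 1"] by simp

lemma rel_ideal_diff: "p \<in> rel_ideal \<Longrightarrow> q \<in> rel_ideal \<Longrightarrow> p - q \<in> rel_ideal"
  using rel_ideal_add[of p "- q"] rel_ideal_uminus[of q] by simp

lemma relations_subset: "relations \<subseteq> rel_ideal"
proof -
  interpret cring gpoly_ring by (rule cring_from_type_algebra)
  show ?thesis
    unfolding rel_ideal_def by (rule genideal_self) (simp add: ring_of_type_algebra_def)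
qed

lemma mem_cls_iff: "q \<in> cls p \<longleftrightarrow> q - p \<in> rel_ideal"
  by (force simp: cls_def a_r_coset_def r_coset_def ring_of_type_algebra_def)

lemma cls_eq_iff: "cls p = cls q \<longleftrightarrow> p - q \<in> rel_ideal"
proof
  show "cls p = cls q \<Longrightarrow> p - q \<in> rel_ideal"
    using mem_cls_iff[of p q] mem_cls_iff[of p p] by (simp add: rel_ideal_zero)
  assume pq: "p - q \<in> rel_ideal"
  have "x - p \<in> rel_ideal \<longleftrightarrow> x - q \<in> rel_ideal" for x
    using rel_ideal_add[OF _ pq, of "x - p"] rel_ideal_diff[OF _ pq, of "x - q"] by auto
  then show "cls p = cls q" by (auto simp: mem_cls_iff)
qed

lemma (in gpoly_endo) rel_ideal_closed:
  assumes "\<And>r. r \<in> relations \<Longrightarrow> f r \<in> rel_ideal" and "p \<in> rel_ideal"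
  shows "f p \<in> rel_ideal"
proof -
  interpret R: cring gpoly_ring by (rule cring_from_type_algebra)
  have "ring_hom_ring gpoly_ring gpoly_ring f"
    by (intro ring_hom_ringI R.ring_axioms) (auto simp: ring_of_type_algebra_def hom_simps)
  then have "ideal {p \<in> carrier gpoly_ring. f p \<in> rel_ideal} gpoly_ring"
    by (rule ring_hom_ring.ideal_vimage) (rule ideal_rel_ideal)
  then have "rel_ideal \<subseteq> {p \<in> carrier gpoly_ring. f p \<in> rel_ideal}"
    unfolding rel_ideal_def by (rule R.genideal_minimal)
      (use assms(1) in \<open>auto simp: ring_of_type_algebra_def rel_ideal_def\<close>)
  then show ?thesis using assms(2) by blast
qed

text \<open>Only the values on the generators have to be inspected in order to see that \<open>f\<close> and \<open>g\<close> are
  inverse to each other.  That \<open>g\<close> preserves the ideal makes the map induced by \<open>f\<close> injective.\<close>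

lemma induced_automorphism:
  assumes f: "gpoly_endo f" and g: "gpoly_endo g"
    and frel: "\<And>r. r \<in> relations \<Longrightarrow> f r \<in> rel_ideal"
    and grel: "\<And>r. r \<in> relations \<Longrightarrow> g r \<in> rel_ideal"
    and fg: "\<And>x. f (g (V x)) = V x" and gf: "\<And>x. g (f (V x)) = V x"
  shows "\<exists>F \<in> carrier Aut\<A>. \<forall>p. F (cls p) = cls (f p)"
proof -
  interpret f: gpoly_endo f by (rule f)
  interpret g: gpoly_endo g by (rule g)
  have "f \<circ> g = id" "g \<circ> f = id"
    using fg gf by (auto intro!: gpoly_endo_eqI gpoly_endo_compose f g gpoly_endo_id)
  then have fg': "f (g p) = p" and gf': "g (f p) = p" for p
    by (metis comp_apply id_apply)+
  have iff: "f p \<in> rel_ideal \<longleftrightarrow> p \<in> rel_ideal" for p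
    using f.rel_ideal_closed[OF frel] g.rel_ideal_closed[OF grel] by (metis gf')
  define F where "F = (\<lambda>x\<in>carrier \<A>. cls (f (SOME p. x = cls p)))"
  have F: "F (cls p) = cls (f p)" for p
  proof -
    have "cls p = cls (SOME q. cls p = cls q)" by (rule someI) simp
    then have "p - (SOME q. cls p = cls q) \<in> rel_ideal" by (simp add: cls_eq_iff)
    then have "cls (f p) = cls (f (SOME q. cls p = cls q))"
      using iff[of "p - (SOME q. cls p = cls q)"] by (simp add: cls_eq_iff f.hom_simps)
    then show ?thesis by (simp add: F_def carrier_\<A>)
  qed
  have "bij_betw F (carrier \<A>) (carrier \<A>)"
    unfolding bij_betw_def
  proof
    show "inj_on F (carrier \<A>)"
      using iff by (auto simp: inj_on_def carrier_\<A> F cls_eq_iff f.diff[symmetric])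
    show "F ` carrier \<A> = carrier \<A>"
      by (auto simp: carrier_\<A> F image_iff) (metis fg')
  qed
  then have "F \<in> Bij (carrier \<A>)"
    by (simp add: Bij_def F_def)
  moreover have "F \<in> ring_hom \<A> \<A>"
    by (rule ring_hom_memI)
      (auto simp: carrier_\<A> F f.hom_simps simp flip: cls_add cls_mult cls_one)
  ultimately have "F \<in> carrier Aut\<A>"
    by (simp add: Aut\<A>_def alg_auto_def F f.hom_simps)
  with F show ?thesis by blast
qed

lemma Aut\<A>_mult_apply:
  assumes "F \<in> carrier Aut\<A>" "G \<in> carrier Aut\<A>"
  shows "(F \<otimes>\<^bsub>Aut\<A>\<^esub> G) (cls p) = F (G (cls p))"
  using assms by (simp add: Aut\<A>_def alg_auto_def BijGroup_def compose_eq carrier_\<A>)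

lemma Aut\<A>_one_apply: "\<one>\<^bsub>Aut\<A>\<^esub> (cls p) = cls p"
  by (simp add: Aut\<A>_def BijGroup_def carrier_\<A>)


section \<open>The substitutions preserve the ideal of relations\<close>

abbreviation d1_sub :: "gpoly \<Rightarrow> gpoly" where
  "d1_sub \<equiv> subst d1_image"

abbreviation I_sub :: "gpoly \<Rightarrow> gpoly" where
  "I_sub \<equiv> subst I_image"

text \<open>The reflection \<open>i \<mapsto> 2 - i\<close> fixes \<open>O_1\<close>, so it preserves the curve of the twist \<open>d_1\<close>.  Being
  orientation reversing, it conjugates \<open>d_1\<close> to its inverse.\<close>

fun reflect_image :: "gen \<Rightarrow> gpoly" where
  "reflect_image O1 = V O1"
| "reflect_image O2 = V O6"
| "reflect_image O3 = V O5"
| "reflect_image O4 = V O4"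
| "reflect_image O5 = V O3"
| "reflect_image O6 = V O2"
| "reflect_image O12 = V O61"
| "reflect_image O23 = V O56"
| "reflect_image O34 = V O45"
| "reflect_image O45 = V O34"
| "reflect_image O56 = V O23"
| "reflect_image O61 = V O12"
| "reflect_image O123 = V O234"
| "reflect_image O234 = V O123"
| "reflect_image O345 = V O345"

abbreviation reflect :: "gpoly \<Rightarrow> gpoly" where
  "reflect \<equiv> subst reflect_image"

interpretation d1: gpoly_endo d1_sub by (rule gpoly_endo_subst)
interpretation I: gpoly_endo I_sub by (rule gpoly_endo_subst)
interpretation reflect: gpoly_endo reflect by (rule gpoly_endo_subst)

lemmas sub_simps = d1.hom_simps I.hom_simps reflect.hom_simps subst_V

lemma relations_eq: "relations = {rel_a 1, rel_a 2, rel_a 3, rel_a 4, rel_a 5, rel_a 6,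
    rel_b 1, rel_b 2, rel_b 3, rel_b 4, rel_b 5, rel_b 6,
    rel_c 1, rel_c 2, rel_c 3, rel_c 4, rel_c 5, rel_c 6, rel_d}"
proof -
  have "{1..6} = {1, 2, 3, 4, 5, 6 :: nat}" by auto
  then show ?thesis unfolding relations_def by auto
qed

lemmas rel_defs = rel_a_def rel_b_def rel_c_def rel_d_def S_def D_def T_def

lemma rels_in: "rel_a 1 \<in> rel_ideal" "rel_a 2 \<in> rel_ideal" "rel_a 3 \<in> rel_ideal"
  "rel_a 4 \<in> rel_ideal" "rel_a 5 \<in> rel_ideal" "rel_a 6 \<in> rel_ideal"
  "rel_b 1 \<in> rel_ideal" "rel_b 2 \<in> rel_ideal" "rel_b 3 \<in> rel_ideal"
  "rel_b 4 \<in> rel_ideal" "rel_b 5 \<in> rel_ideal" "rel_b 6 \<in> rel_ideal"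
  "rel_c 1 \<in> rel_ideal" "rel_c 2 \<in> rel_ideal" "rel_c 3 \<in> rel_ideal"
  "rel_c 4 \<in> rel_ideal" "rel_c 5 \<in> rel_ideal" "rel_c 6 \<in> rel_ideal" "rel_d \<in> rel_ideal"
  using relations_subset unfolding relations_eq by auto

lemma reflect_rels:
  "reflect (rel_a 1) = rel_a 1" "reflect (rel_a 2) = rel_a 6" "reflect (rel_a 3) = rel_a 5"
  "reflect (rel_a 4) = rel_a 4" "reflect (rel_a 5) = rel_a 3" "reflect (rel_a 6) = rel_a 2"
  "reflect (rel_b 1) = rel_b 6" "reflect (rel_b 2) = rel_b 5" "reflect (rel_b 3) = rel_b 4"
  "reflect (rel_b 4) = rel_b 3" "reflect (rel_b 5) = rel_b 2" "reflect (rel_b 6) = rel_b 1"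
  "reflect (rel_c 1) = rel_c 1" "reflect (rel_c 2) = rel_c 6" "reflect (rel_c 3) = rel_c 5"
  "reflect (rel_c 4) = rel_c 4" "reflect (rel_c 5) = rel_c 3" "reflect (rel_c 6) = rel_c 2"
  "reflect rel_d = rel_d"
  by (simp_all add: rel_defs sub_simps algebra_simps)

lemma I_rels:
  "I_sub (rel_a 1) = rel_a 2" "I_sub (rel_a 2) = rel_a 3" "I_sub (rel_a 3) = rel_a 4"
  "I_sub (rel_a 4) = rel_a 5" "I_sub (rel_a 5) = rel_a 6" "I_sub (rel_a 6) = rel_a 1"
  "I_sub (rel_b 1) = rel_b 2" "I_sub (rel_b 2) = rel_b 3" "I_sub (rel_b 3) = rel_b 4"
  "I_sub (rel_b 4) = rel_b 5" "I_sub (rel_b 5) = rel_b 6" "I_sub (rel_b 6) = rel_b 1"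
  "I_sub (rel_c 1) = rel_c 2" "I_sub (rel_c 2) = rel_c 3" "I_sub (rel_c 3) = rel_c 4"
  "I_sub (rel_c 4) = rel_c 5" "I_sub (rel_c 5) = rel_c 6" "I_sub (rel_c 6) = rel_c 1"
  "I_sub rel_d = rel_d"
  by (simp_all add: rel_defs sub_simps algebra_simps)

text \<open>Most relations are fixed or come in pairs on which the twist acts as it does on the pair
  \<open>(O_12, O_2)\<close>, where \<open>O_12 \<mapsto> O_2\<close> and \<open>O_2 \<mapsto> O_1 O_2 - O_12\<close>: up to signs these are
  \<open>(a_2, b_1)\<close>, \<open>(b_6, a_6)\<close>, \<open>(b_2, c_2)\<close> and \<open>(c_6, b_5)\<close>.  Only for \<open>c_3\<close> and \<open>c_5\<close> do
  multiples of several other relations enter.\<close>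

lemma d1_rels:
  "d1_sub (rel_a 1) = rel_a 1"
  "d1_sub (rel_a 2) = - rel_b 1"
  "d1_sub (rel_a 3) = rel_a 3"
  "d1_sub (rel_a 4) = rel_a 4"
  "d1_sub (rel_a 5) = rel_a 5"
  "d1_sub (rel_a 6) = rel_b 6 + V O1 * rel_a 6"
  "d1_sub (rel_b 1) = rel_a 2 + V O1 * rel_b 1"
  "d1_sub (rel_b 2) = rel_c 2"
  "d1_sub (rel_b 3) = rel_b 3"
  "d1_sub (rel_b 4) = rel_b 4"
  "d1_sub (rel_b 5) = V O1 * rel_b 5 - rel_c 6"
  "d1_sub (rel_b 6) = - rel_a 6"
  "d1_sub (rel_c 1) = rel_c 1"
  "d1_sub (rel_c 2) = V O1 * rel_c 2 - rel_b 2"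
  "d1_sub (rel_c 3) = rel_b 5 + V O1 * rel_c 3 - V O123 * rel_a 4 - V O12 * rel_b 3 + V O6 * rel_a 5"
  "d1_sub (rel_c 4) = rel_c 4"
  "d1_sub (rel_c 5) = V O45 * rel_b 6 + V O1 * rel_c 5 - V O3 * rel_a 2 - V O4 * rel_c 6 - rel_b 2
     + V O123 * rel_a 1"
  "d1_sub (rel_c 6) = rel_b 5"
  by (simp_all add: rel_defs sub_simps algebra_simps)

lemma two_neq_zero: "(2 :: kt) \<noteq> 0"
proof -
  have "(2 :: kt) = of_nat 2" by simp
  also have "\<dots> = Fract (of_nat 2) 1" by (rule of_nat_fract)
  also have "\<dots> \<noteq> 0" by (simp add: eq_fract Zero_fract_def)
  finally show ?thesis .
qed

text \<open>With \<open>t^(1/4)\<close> as indeterminate \<open>X\<close>, vanishing of \<open>\<kappa> = X^2 + X^(-2)\<close> would mean \<open>X^4 + 1 = 0\<close>.\<close>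

lemma kappa_neq_zero: "kappa \<noteq> 0"
proof
  let ?t = "[:0, 1:] :: complex poly"
  assume "kappa = 0"
  moreover have "t_quarter \<noteq> 0" by (simp add: t_quarter_def eq_fract Zero_fract_def)
  ultimately have "t_quarter ^ 4 + 1 = 0"
    by (simp add: kappa_def field_simps flip: power_add)
  moreover have "t_quarter ^ 4 + 1 = Fract (?t ^ 4 + 1) 1"
    by (simp add: t_quarter_def One_fract_def power4_eq_xxxx)
  ultimately have "?t ^ 4 + 1 = 0" by (simp add: eq_fract Zero_fract_def)
  then have "poly (?t ^ 4 + 1) 0 = 0" by (simp only: poly_0)
  then show False by simp
qed

text \<open>The relation (d) contains \<open>\<kappa>/2\<close>, whereas (a), (b) and (c) contain \<open>\<kappa>\<close>.  Expressing the latter by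
  the former turns identities between them into polynomial identities with integer coefficients.\<close>

lemma const_kappa_eq: "const kappa = const (kappa / 2) + const (kappa / 2)"
proof -
  have "kappa / 2 + kappa / 2 = (2 * kappa) / 2" by (simp only: add_divide_distrib mult_2)
  also have "\<dots> = kappa" using two_neq_zero by simp
  finally show ?thesis by (simp only: const_add[symmetric])
qed

text \<open>Division by nonzero scalars is possible modulo the relations.  It is used for the factor 2 in
  \<open>d1_rel_d\<close> and for the factor \<open>\<kappa>\<close> in the proof that \<open>d_1 I\<close> has order five.\<close>

lemma rel_ideal_cancel: "c \<noteq> 0 \<Longrightarrow> const c * p \<in> rel_ideal \<Longrightarrow> p \<in> rel_ideal"
  using rel_ideal_mult[of "const c * p" "const (inverse c)"]
  by (simp flip: mult.assoc const_mult)

text \<open>The twist changes \<open>rel_d\<close> by a combination of (a), (b), (c) whose multipliers have coefficients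
  \<open>\<plusminus>1/2\<close>.  Doubling clears the denominators.\<close>

lemma d1_rel_d:
  "d1_sub rel_d + d1_sub rel_d = rel_d + rel_d
     - V O61 * rel_b 6 + V O6 * rel_a 6 - V O56 * rel_b 5 - V O234 * rel_c 6
     - V O23 * rel_b 2 + V O2 * rel_a 2 - V O123 * rel_c 2 - V O12 * rel_b 1
     + V O1 * (V O234 * rel_b 5 + V O23 * rel_c 2 + V O2 * rel_b 1 - V O61 * rel_a 6)"
  by (simp add: rel_defs sub_simps const_kappa_eq power2_eq_square algebra_simps)

lemma const_2: "const 2 = 2"
  using const_add[of 1 1] by simp

lemma reflect_relations: "r \<in> relations \<Longrightarrow> reflect r \<in> rel_ideal"
  unfolding relations_eq by (auto simp: reflect_rels rels_in simp del: One_nat_def)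

lemma I_relations: "r \<in> relations \<Longrightarrow> I_sub r \<in> rel_ideal"
  unfolding relations_eq by (auto simp: I_rels rels_in simp del: One_nat_def)

lemma d1_relations: "r \<in> relations \<Longrightarrow> d1_sub r \<in> rel_ideal"
proof -
  have "d1_sub rel_d + d1_sub rel_d \<in> rel_ideal"
    unfolding d1_rel_d by (intro rel_ideal_add rel_ideal_diff rel_ideal_mult rels_in)
  then have "d1_sub rel_d \<in> rel_ideal"
    using rel_ideal_cancel[OF two_neq_zero, of "d1_sub rel_d"] by (simp only: const_2 mult_2)
  then show "r \<in> relations \<Longrightarrow> d1_sub r \<in> rel_ideal"
    unfolding relations_eq
    by (auto simp: d1_rels simp del: One_nat_def intro!: rels_in
       rel_ideal_add rel_ideal_diff rel_ideal_uminus rel_ideal_mult)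
qed

lemma ideal_closed:
  assumes "p \<in> rel_ideal"
  shows "d1_sub p \<in> rel_ideal" "I_sub p \<in> rel_ideal" "reflect p \<in> rel_ideal"
  using assms d1.rel_ideal_closed[OF d1_relations] I.rel_ideal_closed[OF I_relations]
    reflect.rel_ideal_closed[OF reflect_relations]
  by blast+


section \<open>Identities between the substitutions\<close>

text \<open>On the hexagon of indices the composition of a rotation and a reflection is a reflection, so
  \<open>s I s\<close> is the inverse rotation.\<close>

abbreviation I_inv_sub :: "gpoly \<Rightarrow> gpoly" where
  "I_inv_sub p \<equiv> reflect (I_sub (reflect p))"

abbreviation d1_inv_sub :: "gpoly \<Rightarrow> gpoly" where
  "d1_inv_sub p \<equiv> reflect (d1_sub (reflect p))"

lemma d1_inverse: "d1_sub (d1_inv_sub (V x)) = V x" "d1_inv_sub (d1_sub (V x)) = V x"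
  by (cases x; simp add: sub_simps)+

lemma I_inverse: "I_sub (I_inv_sub (V x)) = V x" "I_inv_sub (I_sub (V x)) = V x"
  by (cases x; simp add: sub_simps)+

lemma I_order_6: "(I_sub ^^ 6) (V x) = V x"
  by (cases x; simp add: numeral_eq_Suc sub_simps)

lemma braid_d1_d2:
  "d1_sub (I_sub (d1_sub (I_inv_sub (d1_sub (V x)))))
    = I_sub (d1_sub (I_inv_sub (d1_sub (I_sub (d1_sub (I_inv_sub (V x)))))))"
  by (cases x; simp add: sub_simps algebra_simps)

lemma commute_d1_d3:
  "d1_sub (I_sub (I_sub (d1_sub (I_inv_sub (I_inv_sub (V x))))))
    = I_sub (I_sub (d1_sub (I_inv_sub (I_inv_sub (d1_sub (V x))))))"
  by (cases x; simp add: sub_simps algebra_simps)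

lemma commute_d1_d4:
  "d1_sub (I_sub (I_sub (I_sub (d1_sub (I_inv_sub (I_inv_sub (I_inv_sub (V x))))))))
    = I_sub (I_sub (I_sub (d1_sub (I_inv_sub (I_inv_sub (I_inv_sub (d1_sub (V x))))))))"
  by (cases x; simp add: sub_simps algebra_simps)

lemma I_inv_d1_order_5: "((\<lambda>p. I_inv_sub (d1_sub p)) ^^ 5) (V x) = V x"
  by (cases x; simp add: numeral_eq_Suc sub_simps algebra_simps)


section \<open>The composition of the twist and the rotation has order five\<close>

abbreviation rot :: "gpoly \<Rightarrow> gpoly" where
  "rot p \<equiv> d1_sub (I_sub p)"

lemma rot_cong: "cls p = cls q \<Longrightarrow> cls (rot p) = cls (rot q)"
  using ideal_closed(1)[OF ideal_closed(2)[of "p - q"]] by (simp add: cls_eq_iff sub_simps)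

text \<open>The third image of \<open>O_6\<close> under \<open>rot\<close> is \<open>O_1 O_2 O_3 - O_12 O_3 - O_1 O_23 + O_123\<close>, and the
  expression subtracted below is its translate under \<open>i \<mapsto> i + 3\<close>, as \<open>O_456 = O_123\<close>.  In the relation
  (c) the terms without \<open>\<kappa>\<close> are invariant under \<open>i \<mapsto> i + 3\<close>, so the difference of the relations for
  \<open>i = 2\<close> and \<open>i = 5\<close> is divisible by \<open>\<kappa>\<close>, and the quotient is the difference of these two polynomials.\<close>

lemma kappa_times_hexagon:
  "const kappa * (rot (rot (rot (V O6)))
    - (V O4 * V O5 * V O6 - V O4 * V O56 - V O6 * V O45 + V O123)) = rel_c 2 - rel_c 5"
  by (simp add: sub_simps rel_defs algebra_simps)

lemma rot_rot_opposite:
  "rot (rot (V O4 * V O5 * V O6 - V O4 * V O56 - V O6 * V O45 + V O123)) = V O6"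
  by (simp add: sub_simps rel_defs algebra_simps)

text \<open>The elements that \<open>rot\<close> composed five times fixes modulo the relations form a subring that is
  stable under \<open>rot\<close>.  It contains \<open>O_6\<close> by the two preceding identities, hence \<open>O_1 = rot O_6\<close>, and it
  contains the two cycles of generators
  \<open>O_2, O_3, O_4, O_5, O_61\<close> and \<open>O_23, O_34, O_45, O_234, O_345\<close>.  The remaining three generators
  are reached through \<open>O_12 = O_1 O_2 - rot O_1\<close>, \<open>O_123 = O_1 O_23 - rot O_12\<close> and
  \<open>O_56 = O_1 O_234 - rot O_123\<close>.\<close>

lemma rot_order_5: "cls ((rot ^^ 5) (V x)) = cls (V x)"
proof -
  interpret rot: gpoly_endo rot
    using gpoly_endo_compose[OF d1.gpoly_endo_axioms I.gpoly_endo_axioms] by (simp add: comp_def)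
  interpret R: gpoly_endo "rot ^^ 5"
    by unfold_locales (simp_all add: numeral_eq_Suc rot.hom_simps)
  let ?fixed = "\<lambda>p. cls ((rot ^^ 5) p) = cls p"
  have fixed_rot: "?fixed (rot p)" if "?fixed p" for p
    using rot_cong[OF that] by (simp add: numeral_eq_Suc)
  have fixed_diff: "?fixed (p - q)" if "?fixed p" "?fixed q" for p q
    using that rel_ideal_diff[of "(rot ^^ 5) p - p" "(rot ^^ 5) q - q"]
    by (simp add: cls_eq_iff R.diff algebra_simps)
  have fixed_mult: "?fixed (p * q)" if "?fixed p" "?fixed q" for p q
  proof -
    have "(rot ^^ 5) (p * q) - p * q = (rot ^^ 5) p * ((rot ^^ 5) q - q) + q * ((rot ^^ 5) p - p)"
      by (simp add: R.mult algebra_simps)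
    then show ?thesis
      using that by (simp add: cls_eq_iff rel_ideal_add rel_ideal_mult)
  qed
  \<comment> \<open>\<open>?Y\<close> is the image of \<open>O_6\<close> under the inverse of \<open>rot\<close>, applied twice; if \<open>rot\<close> has order
    five, it must agree with the third image of \<open>O_6\<close>.\<close>
  let ?Y = "V O4 * V O5 * V O6 - V O4 * V O56 - V O6 * V O45 + V O123"
  have "const kappa * (rot (rot (rot (V O6))) - ?Y) \<in> rel_ideal"
    unfolding kappa_times_hexagon by (intro rel_ideal_diff rels_in)
  then have "cls (rot (rot (rot (V O6)))) = cls ?Y"
    unfolding cls_eq_iff by (rule rel_ideal_cancel[OF kappa_neq_zero])
  then have "cls (rot (rot (rot (rot (rot (V O6)))))) = cls (rot (rot ?Y))"
    by (intro rot_cong)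
  then have O6: "?fixed (V O6)"
    by (simp only: rot_rot_opposite) (simp add: numeral_eq_Suc)
  have O1: "?fixed (V O1)"
    using fixed_rot[OF O6] by (simp add: sub_simps)
  have free: "?fixed (V y)" if "y \<in> {O2, O3, O4, O5, O61, O23, O34, O45, O234, O345}" for y
    using that by (auto simp: numeral_eq_Suc sub_simps)
  have O12: "?fixed (V O12)"
    using fixed_diff[OF fixed_mult[OF O1 free[of O2]] fixed_rot[OF O1]] by (simp add: sub_simps)
  have O123: "?fixed (V O123)"
    using fixed_diff[OF fixed_mult[OF O1 free[of O23]] fixed_rot[OF O12]] by (simp add: sub_simps)
  have O56: "?fixed (V O56)"
    using fixed_diff[OF fixed_mult[OF O1 free[of O234]] fixed_rot[OF O123]] by (simp add: sub_simps)
  show ?thesis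
    by (cases x) (simp_all add: O6 O1 O12 O123 O56 free)
qed


section \<open>Homomorphisms from a group given by a presentation\<close>

definition word_val :: "('g, 'm) monoid_scheme \<Rightarrow> ('a \<Rightarrow> 'g) \<Rightarrow> 'a word \<Rightarrow> 'g" where
  "word_val H f w = foldr (\<lambda>(a, b) y. (if b then f a else inv\<^bsub>H\<^esub> (f a)) \<otimes>\<^bsub>H\<^esub> y) w \<one>\<^bsub>H\<^esub>"

context group begin

lemma word_val_Nil [simp]: "word_val G f [] = \<one>"
  and word_val_Cons [simp]:
    "word_val G f ((a, b) # w) = (if b then f a else inv (f a)) \<otimes> word_val G f w"
  by (simp_all add: word_val_def)

lemma word_val_closed [simp]:
  "f \<in> A \<rightarrow> carrier G \<Longrightarrow> w \<in> lists (A \<times> UNIV) \<Longrightarrow> word_val G f w \<in> carrier G"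
  by (induction w) (auto simp: Pi_iff)

lemma word_val_append:
  "f \<in> A \<rightarrow> carrier G \<Longrightarrow> u \<in> lists (A \<times> UNIV) \<Longrightarrow> v \<in> lists (A \<times> UNIV) \<Longrightarrow>
    word_val G f (u @ v) = word_val G f u \<otimes> word_val G f v"
proof (induction u)
  case (Cons x u)
  then have "word_val G f u \<in> carrier G" "word_val G f v \<in> carrier G" "f (fst x) \<in> carrier G"
    by (auto simp: Pi_iff)
  with Cons show ?case
    by (cases x) (auto simp: m_assoc)
qed simp

lemma word_val_pres_rel:
  assumes f: "f \<in> A \<rightarrow> carrier G"
    and rel: "\<And>l r. (l, r) \<in> R \<Longrightarrow> word_val G f l = word_val G f r"
    and uv: "(u, v) \<in> pres_rel A R"
  shows "word_val G f u = word_val G f v"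
  using uv
proof induction
  case (app u v u' v')
  then show ?case
    using pres_rel_lists[OF app.hyps(1)] pres_rel_lists[OF app.hyps(2)]
    by (simp add: word_val_append[OF f])
next
  case (cancel a b)
  then have "f a \<in> carrier G" using f by blast
  then show ?case by simp
qed (simp_all add: rel)

lemma presented_group_universal:
  assumes f: "f \<in> A \<rightarrow> carrier G"
    and rel: "\<And>l r. (l, r) \<in> R \<Longrightarrow> word_val G f l = word_val G f r"
  shows "\<exists>\<phi> \<in> hom (presented_group A R) G.
    \<forall>w \<in> lists (A \<times> UNIV). \<phi> (pres_rel A R `` {w}) = word_val G f w"
proof -
  define \<phi> where "\<phi> = (\<lambda>U. word_val G f (SOME u. u \<in> U))"
  have \<phi>: "\<phi> (pres_rel A R `` {w}) = word_val G f w" if "w \<in> lists (A \<times> UNIV)" for w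
  proof -
    have "(SOME u. u \<in> pres_rel A R `` {w}) \<in> pres_rel A R `` {w}"
      by (rule someI[of _ w]) (simp add: pres_rel.refl that)
    then show ?thesis
      unfolding \<phi>_def using word_val_pres_rel[OF f rel] by fastforce
  qed
  have "\<phi> \<in> hom (presented_group A R) G"
  proof (rule homI)
    fix x assume "x \<in> carrier (presented_group A R)"
    then obtain u where u: "u \<in> lists (A \<times> UNIV)" "x = pres_rel A R `` {u}"
      by (auto simp: presented_group_def quotient_def)
    then show "\<phi> x \<in> carrier G"
      by (simp add: \<phi> word_val_closed[OF f])
    fix y assume "y \<in> carrier (presented_group A R)"
    then obtain v where v: "v \<in> lists (A \<times> UNIV)" "y = pres_rel A R `` {v}"
      by (auto simp: presented_group_def quotient_def)
    have "u @ v \<in> lists (A \<times> UNIV)" using u v by simp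
    then show "\<phi> (x \<otimes>\<^bsub>presented_group A R\<^esub> y) = \<phi> x \<otimes> \<phi> y"
      using u v by (simp only: presented_group_mult \<phi> word_val_append[OF f])
  qed
  with \<phi> show ?thesis by blast
qed

end


section \<open>A chain of conjugates satisfying the relations of the mapping class group\<close>

context group begin

lemma conj_pow_mult:
  assumes "a \<in> carrier G" "x \<in> carrier G" "y \<in> carrier G"
  shows "(a [^] (k::int) \<otimes> x \<otimes> a [^] (- k)) \<otimes> (a [^] k \<otimes> y \<otimes> a [^] (- k)) = a [^] k \<otimes> (x \<otimes> y) \<otimes> a [^] (- k)"
proof -
  have "a [^] (- k) \<otimes> (a [^] k \<otimes> z) = z" if "z \<in> carrier G" for z
    using that assms int_pow_mult[OF assms(1), of "-k" k] by (simp flip: m_assoc)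
  then show ?thesis using assms by (simp add: m_assoc)
qed

text \<open>For \<open>a = I\<close> and \<open>d = d_1\<close> this is the chain \<open>d_1, d_2, \<dots>\<close> of Dehn twists.  Indices beyond 5 occur
  when \<open>d_1\<close> and \<open>d_5\<close> are compared, by way of \<open>d_7 = d_1\<close>.\<close>

definition shifted :: "'a \<Rightarrow> 'a \<Rightarrow> nat \<Rightarrow> 'a" where
  "shifted a d i = a [^] (int i - 1) \<otimes> d \<otimes> a [^] (1 - int i)"

context
  fixes a d assumes a: "a \<in> carrier G" and d: "d \<in> carrier G"
begin

lemma shifted_closed [simp]: "shifted a d i \<in> carrier G"
  using a d by (simp add: shifted_def)

lemma shifted_conj: "a [^] int k \<otimes> shifted a d i \<otimes> a [^] (- int k) = shifted a d (i + k)"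
proof -
  have "a [^] (int (i + k) - 1) = a [^] int k \<otimes> a [^] (int i - 1)"
    by (subst int_pow_mult[OF a, symmetric]) (simp add: algebra_simps)
  moreover have "a [^] (1 - int (i + k)) = a [^] (1 - int i) \<otimes> a [^] (- int k)"
    by (subst int_pow_mult[OF a, symmetric]) (simp add: algebra_simps)
  ultimately show ?thesis
    using a d unfolding shifted_def by (simp add: m_assoc)
qed

lemma shifted_braid:
  assumes "shifted a d i \<otimes> shifted a d j \<otimes> shifted a d i
    = shifted a d j \<otimes> shifted a d i \<otimes> shifted a d j"
  shows "shifted a d (i + k) \<otimes> shifted a d (j + k) \<otimes> shifted a d (i + k)
    = shifted a d (j + k) \<otimes> shifted a d (i + k) \<otimes> shifted a d (j + k)"
  using assms by (simp flip: shifted_conj add: conj_pow_mult a)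

lemma shifted_commute:
  assumes "shifted a d i \<otimes> shifted a d j = shifted a d j \<otimes> shifted a d i"
  shows "shifted a d (i + k) \<otimes> shifted a d (j + k) = shifted a d (j + k) \<otimes> shifted a d (i + k)"
  using assms by (simp flip: shifted_conj add: conj_pow_mult a)

text \<open>Consecutive factors \<open>a^(1-i)\<close> and \<open>a^i\<close> of neighbours in the chain cancel down to one \<open>a\<close>, so
  the products telescope to powers of \<open>d a\<close> or of \<open>a^(-1) d\<close>.  The next two lemmas are the induction
  steps.\<close>

lemma shifted_prod_up:
  "(d \<otimes> a) [^] n \<otimes> a [^] (- int n) \<otimes> shifted a d (Suc n)
    = (d \<otimes> a) [^] Suc n \<otimes> a [^] (- int (Suc n))"
proof -
  have "a [^] (- int n) \<otimes> (a [^] int n \<otimes> y) = y" if "y \<in> carrier G" for y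
    using that a int_pow_mult[OF a, of "- int n" "int n"] by (simp flip: m_assoc)
  moreover have "a [^] (- int n) = a \<otimes> a [^] (- int (Suc n))"
    using int_pow_mult[OF a, of 1 "- int (Suc n)"] a by (simp add: int_pow_1)
  ultimately show ?thesis
    using a d by (simp add: shifted_def m_assoc)
qed

lemma shifted_prod_down:
  "shifted a d (Suc n) \<otimes> (a [^] n \<otimes> (inv a \<otimes> d) [^] n) = a [^] Suc n \<otimes> (inv a \<otimes> d) [^] Suc n"
proof -
  have "a [^] (- int n) \<otimes> (a [^] int n \<otimes> y) = y" if "y \<in> carrier G" for y
    using that a int_pow_mult[OF a, of "- int n" "int n"] by (simp flip: m_assoc)
  moreover have "a \<otimes> (inv a \<otimes> y) = y" if "y \<in> carrier G" for y
    using that a by (simp flip: m_assoc)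
  moreover have "(inv a \<otimes> d) [^] n \<otimes> (inv a \<otimes> d) = inv a \<otimes> d \<otimes> (inv a \<otimes> d) [^] n"
    using a d by (metis inv_closed m_closed nat_pow_Suc nat_pow_Suc2)
  ultimately show ?thesis
    using a d by (simp add: shifted_def m_assoc int_pow_int)
qed

lemma shifted_periodic:
  assumes a6: "a [^] (6::nat) = \<one>"
  shows "shifted a d (i + 6) = shifted a d i"
proof -
  have "a [^] int 6 = \<one>" using a6 by (simp only: int_pow_int)
  moreover from this have "a [^] (- int 6) = \<one>" using a by (simp only: int_pow_neg inv_one)
  ultimately show ?thesis
    using shifted_conj[of 6 i] by simp
qed

lemma shifted_prod_1_to_5:
  assumes a6: "a [^] (6::nat) = \<one>" and da5: "(d \<otimes> a) [^] (5::nat) = \<one>"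
  shows "shifted a d 1 \<otimes> shifted a d 2 \<otimes> shifted a d 3 \<otimes> shifted a d 4 \<otimes> shifted a d 5 = a"
proof -
  have "shifted a d 1 \<otimes> shifted a d 2 \<otimes> shifted a d 3 \<otimes> shifted a d 4 \<otimes> shifted a d 5
      = (d \<otimes> a) [^] (5::nat) \<otimes> a [^] (- int 5)"
    using shifted_prod_up[of 0] shifted_prod_up[of 1] shifted_prod_up[of 2]
      shifted_prod_up[of 3] shifted_prod_up[of 4] a d
    by (simp add: numeral_eq_Suc)
  also have "a [^] (- int 5) = a [^] (- int 5) \<otimes> a [^] int 6"
    using a6 a by (simp only: int_pow_int r_one int_pow_closed)
  also have "\<dots> = a"
    by (subst int_pow_mult[OF a, symmetric]) (simp add: a int_pow_1)
  finally show ?thesis using a by (simp add: da5)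
qed

lemma shifted_prod_5_to_1:
  assumes ad5: "(inv a \<otimes> d) [^] (5::nat) = \<one>"
  shows "shifted a d 5 \<otimes> (shifted a d 4 \<otimes> (shifted a d 3 \<otimes> (shifted a d 2 \<otimes> shifted a d 1)))
    = a [^] (5::nat)"
  using shifted_prod_down[of 0] shifted_prod_down[of 1] shifted_prod_down[of 2]
      shifted_prod_down[of 3] shifted_prod_down[of 4] ad5 a d
  by (simp add: numeral_eq_Suc)

text \<open>The word \<open>H\<close> is the ascending product \<open>a\<close> times the descending product \<open>a^5\<close>, hence it has
  the value 1.  Commutation at distance two and three follows from the first two instances by
  conjugation; the indices 1 and 5 have cyclic distance two, and \<open>a^6 = 1\<close> lets the
  indices be read modulo 6.\<close>

lemma Mod2_relations_shifted:
  assumes a6: "a [^] (6::nat) = \<one>"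
    and da5: "(d \<otimes> a) [^] (5::nat) = \<one>"
    and ad5: "(inv a \<otimes> d) [^] (5::nat) = \<one>"
    and braid: "shifted a d 1 \<otimes> shifted a d 2 \<otimes> shifted a d 1
      = shifted a d 2 \<otimes> shifted a d 1 \<otimes> shifted a d 2"
    and comm3: "shifted a d 1 \<otimes> shifted a d 3 = shifted a d 3 \<otimes> shifted a d 1"
    and comm4: "shifted a d 1 \<otimes> shifted a d 4 = shifted a d 4 \<otimes> shifted a d 1"
    and rel: "(l, r) \<in> Mod2_relations"
  shows "word_val G (shifted a d) l = word_val G (shifted a d) r"
proof -
  let ?f = "shifted a d"
  have f: "?f \<in> UNIV \<rightarrow> carrier G" by simp
  note append = word_val_append[OF f]
  have I: "word_val G ?f I_word = a"
    using shifted_prod_1_to_5[OF a6 da5] by (simp add: I_word_def m_assoc)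
  have H: "word_val G ?f H_word = \<one>"
  proof -
    have "word_val G ?f H_word = word_val G ?f (I_word @ tw 5 @ tw 4 @ tw 3 @ tw 2 @ tw 1)"
      by (simp add: H_word_def I_word_def)
    also have "\<dots> = a \<otimes> word_val G ?f (tw 5 @ tw 4 @ tw 3 @ tw 2 @ tw 1)"
      by (subst append) (simp_all add: I)
    also have "word_val G ?f (tw 5 @ tw 4 @ tw 3 @ tw 2 @ tw 1) = a [^] (5::nat)"
      using shifted_prod_5_to_1[OF ad5] by simp
    also have "a \<otimes> a [^] (5::nat) = \<one>"
      using a a6 nat_pow_mult[OF a, of 1 5] by simp
    finally show ?thesis .
  qed
  have comm: "?f i \<otimes> ?f j = ?f j \<otimes> ?f i" if ij: "i \<in> {1..5}" "i + 1 < j" "j \<le> 5" for i j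
  proof -
    consider "j = i + 2" | "j = i + 3" | "i = 1" "j = 5"
      using ij by fastforce
    then show ?thesis
    proof cases
      case 1
      then show ?thesis using shifted_commute[OF comm3, of "i - 1"] ij by simp
    next
      case 2
      then show ?thesis using shifted_commute[OF comm4, of "i - 1"] ij by (simp add: add.commute)
    next
      case 3
      then show ?thesis
        using shifted_commute[OF comm3, of 4] shifted_periodic[OF a6, of 1] by simp
    qed
  qed
  from rel consider
      i where "i \<in> {1..4}" "l = tw i @ tw (i+1) @ tw i" "r = tw (i+1) @ tw i @ tw (i+1)"
    | i j where "i \<in> {1..5}" "j \<in> {1..5}" "\<bar>int i - int j\<bar> > 1" "l = tw i @ tw j" "r = tw j @ tw i"
    | "l = I_word @ I_word @ I_word @ I_word @ I_word @ I_word" "r = []"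
    | "l = H_word @ H_word" "r = []"
    | i where "l = H_word @ tw i" "r = tw i @ H_word"
    unfolding Mod2_relations_def by blast
  then show ?thesis
  proof cases
    case (1 i)
    then show ?thesis
      using shifted_braid[OF braid, of "i - 1"] by (simp add: m_assoc)
  next
    case (2 i j)
    then show ?thesis
      using comm[of i j] comm[of j i] by (cases "i < j") auto
  next
    case 3
    then show ?thesis
      using a6 a by (simp add: append I numeral_eq_Suc m_assoc)
  qed (simp_all add: append H)
qed

end

end


section \<open>The action of the mapping class group\<close>

theorem proposition14:
  shows "\<exists>d\<^sub>1 \<in> carrier Aut\<A>. \<exists>I \<in> carrier Aut\<A>.
      (\<forall>g. d\<^sub>1 (cls (V g)) = cls (d1_image g)) \<and>
      (\<forall>g. I (cls (V g)) = cls (I_image g)) \<and>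
      (\<exists>\<phi> \<in> hom Mod2 Aut\<A>.
        (\<forall>i \<in> {1..5}. \<phi> (dehn i) =
           I [^]\<^bsub>Aut\<A>\<^esub> (int i - 1) \<otimes>\<^bsub>Aut\<A>\<^esub> d\<^sub>1 \<otimes>\<^bsub>Aut\<A>\<^esub> I [^]\<^bsub>Aut\<A>\<^esub> (1 - int i)) \<and>
        \<phi> (dehn 1 \<otimes>\<^bsub>Mod2\<^esub> dehn 2 \<otimes>\<^bsub>Mod2\<^esub> dehn 3 \<otimes>\<^bsub>Mod2\<^esub> dehn 4 \<otimes>\<^bsub>Mod2\<^esub> dehn 5) = I)"
proof -
  interpret Aut: group Aut\<A> by (rule group_Aut\<A>)
  have sub: "gpoly_endo d1_sub" "gpoly_endo I_sub" "gpoly_endo d1_inv_sub"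
    "gpoly_endo I_inv_sub"
    by unfold_locales (simp_all add: sub_simps)
  have closed: "d1_inv_sub r \<in> rel_ideal" "I_inv_sub r \<in> rel_ideal"
    if "r \<in> relations" for r
    using that by (simp_all add: ideal_closed reflect_relations)
  obtain D where D: "D \<in> carrier Aut\<A>" and D_cls: "\<And>p. D (cls p) = cls (d1_sub p)"
    using induced_automorphism[OF sub(1) sub(3) d1_relations closed(1)] d1_inverse by blast
  obtain A where A: "A \<in> carrier Aut\<A>" and A_cls: "\<And>p. A (cls p) = cls (I_sub p)"
    using induced_automorphism[OF sub(2) sub(4) I_relations closed(2)] I_inverse by blast
  obtain B where B: "B \<in> carrier Aut\<A>" and B_cls: "\<And>p. B (cls p) = cls (I_inv_sub p)"
    using induced_automorphism[OF sub(4) sub(2) closed(2) I_relations] I_inverse by blast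
  note apply_simps = Aut\<A>_mult_apply Aut\<A>_one_apply D A B D_cls A_cls B_cls
  have "A \<otimes>\<^bsub>Aut\<A>\<^esub> B = \<one>\<^bsub>Aut\<A>\<^esub>"
    by (rule Aut\<A>_eqI) (simp_all add: apply_simps I_inverse)
  then have inv_A: "inv\<^bsub>Aut\<A>\<^esub> A = B"
    using A B Aut.inv_equality Aut.inv_comm by blast
  have pow_apply: "(F [^]\<^bsub>Aut\<A>\<^esub> n) (cls p) = cls ((f ^^ n) p)"
    if "F \<in> carrier Aut\<A>" "\<And>p. F (cls p) = cls (f p)" for F f p and n :: nat
    using that(1)
    by (induction n arbitrary: p) (simp_all add: Aut\<A>_one_apply Aut\<A>_mult_apply that(2) funpow_swap1)
  let ?t = "Aut.shifted A D"
  have t_closed: "?t i \<in> carrier Aut\<A>" for i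
    by (rule Aut.shifted_closed[OF A D])
  have t_Suc: "?t (Suc n) = A [^]\<^bsub>Aut\<A>\<^esub> n \<otimes>\<^bsub>Aut\<A>\<^esub> D \<otimes>\<^bsub>Aut\<A>\<^esub> B [^]\<^bsub>Aut\<A>\<^esub> n" for n
    using A by (simp add: Aut.shifted_def int_pow_int Aut.int_pow_neg_int Aut.nat_pow_inv flip: inv_A)
  have t_cls: "?t (Suc n) (cls p) = cls ((I_sub ^^ n) (d1_sub ((I_inv_sub ^^ n) p)))" for n p
    using pow_apply[OF A A_cls] pow_apply[OF B B_cls] by (simp add: t_Suc apply_simps)
  have A6: "A [^]\<^bsub>Aut\<A>\<^esub> (6::nat) = \<one>\<^bsub>Aut\<A>\<^esub>"
    by (rule Aut\<A>_eqI) (simp_all add: apply_simps pow_apply I_order_6)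
  have DA5: "(D \<otimes>\<^bsub>Aut\<A>\<^esub> A) [^]\<^bsub>Aut\<A>\<^esub> (5::nat) = \<one>\<^bsub>Aut\<A>\<^esub>"
  proof (rule Aut\<A>_eqI)
    fix x
    have "((D \<otimes>\<^bsub>Aut\<A>\<^esub> A) [^]\<^bsub>Aut\<A>\<^esub> (5::nat)) (cls (V x)) = cls ((rot ^^ 5) (V x))"
      by (rule pow_apply) (simp_all add: apply_simps)
    then show "((D \<otimes>\<^bsub>Aut\<A>\<^esub> A) [^]\<^bsub>Aut\<A>\<^esub> (5::nat)) (cls (V x)) = \<one>\<^bsub>Aut\<A>\<^esub> (cls (V x))"
      by (simp only: rot_order_5 Aut\<A>_one_apply)
  qed (simp_all add: A D)
  have AD5: "(inv\<^bsub>Aut\<A>\<^esub> A \<otimes>\<^bsub>Aut\<A>\<^esub> D) [^]\<^bsub>Aut\<A>\<^esub> (5::nat) = \<one>\<^bsub>Aut\<A>\<^esub>"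
    unfolding inv_A
  proof (rule Aut\<A>_eqI)
    fix x
    have "((B \<otimes>\<^bsub>Aut\<A>\<^esub> D) [^]\<^bsub>Aut\<A>\<^esub> (5::nat)) (cls (V x)) = cls (((\<lambda>p. I_inv_sub (d1_sub p)) ^^ 5) (V x))"
      by (rule pow_apply) (simp_all add: apply_simps)
    then show "((B \<otimes>\<^bsub>Aut\<A>\<^esub> D) [^]\<^bsub>Aut\<A>\<^esub> (5::nat)) (cls (V x)) = \<one>\<^bsub>Aut\<A>\<^esub> (cls (V x))"
      by (simp only: I_inv_d1_order_5 Aut\<A>_one_apply)
  qed (simp_all add: B D)
  have braid: "?t 1 \<otimes>\<^bsub>Aut\<A>\<^esub> ?t 2 \<otimes>\<^bsub>Aut\<A>\<^esub> ?t 1 = ?t 2 \<otimes>\<^bsub>Aut\<A>\<^esub> ?t 1 \<otimes>\<^bsub>Aut\<A>\<^esub> ?t 2"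
    by (rule Aut\<A>_eqI)
      (simp_all add: Aut\<A>_mult_apply t_closed t_cls numeral_eq_Suc braid_d1_d2)
  have comm3: "?t 1 \<otimes>\<^bsub>Aut\<A>\<^esub> ?t 3 = ?t 3 \<otimes>\<^bsub>Aut\<A>\<^esub> ?t 1"
    by (rule Aut\<A>_eqI)
      (simp_all add: Aut\<A>_mult_apply t_closed t_cls numeral_eq_Suc commute_d1_d3)
  have comm4: "?t 1 \<otimes>\<^bsub>Aut\<A>\<^esub> ?t 4 = ?t 4 \<otimes>\<^bsub>Aut\<A>\<^esub> ?t 1"
    by (rule Aut\<A>_eqI)
      (simp_all add: Aut\<A>_mult_apply t_closed t_cls numeral_eq_Suc commute_d1_d4)
  have t_funcset: "?t \<in> {1..5} \<rightarrow> carrier Aut\<A>"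
    using t_closed by simp
  have "word_val Aut\<A> ?t l = word_val Aut\<A> ?t r" if "(l, r) \<in> Mod2_relations" for l r
    by (rule Aut.Mod2_relations_shifted[OF A D A6 DA5 AD5 braid comm3 comm4 that])
  then obtain \<phi> where \<phi>: "\<phi> \<in> hom Mod2 Aut\<A>"
    and \<phi>_word: "\<forall>w \<in> lists ({1..5} \<times> UNIV).
      \<phi> (pres_rel {1..5} Mod2_relations `` {w}) = word_val Aut\<A> ?t w"
    unfolding Mod2_def
    using Aut.presented_group_universal[OF t_funcset, of Mod2_relations] by metis
  have \<phi>_dehn: "\<phi> (dehn i) = ?t i" if "i \<in> {1..5}" for i
    using bspec[OF \<phi>_word, of "tw i"] that t_closed by (simp add: dehn_def)
  have dehn: "dehn i \<in> carrier Mod2" if "i \<in> {1..5}" for i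
    using that by (simp add: dehn_def Mod2_def presented_group_def quotientI)
  interpret Mod2: group Mod2 by (rule group_Mod2)
  have "\<phi> (dehn 1 \<otimes>\<^bsub>Mod2\<^esub> dehn 2 \<otimes>\<^bsub>Mod2\<^esub> dehn 3 \<otimes>\<^bsub>Mod2\<^esub> dehn 4 \<otimes>\<^bsub>Mod2\<^esub> dehn 5) = A"
    using Aut.shifted_prod_1_to_5[OF A D A6 DA5]
    by (simp add: hom_mult[OF \<phi>] dehn \<phi>_dehn)
  then show ?thesis
    using D A \<phi> by (intro bexI[of _ D] bexI[of _ A] bexI[of _ \<phi>] conjI allI ballI)
      (simp_all add: D_cls A_cls subst_V \<phi>_dehn Aut.shifted_def)
qed

end
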